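(* Let $G=(V,E)$ be a locally finite, connected, simple, unweighted $C_4$-free graph with minimum degree $\delta(G)\ge 2$, equipped with the normalized Laplacian $\Delta f(x)=\frac{1}{d_x}\sum_{y\sim x}(f(y)-f(x))$. If $G$ satisfies $CD(0,\infty)$ and contains at least one triangle, then $G\cong F_k$ for some $1\le k\le 7$.
   Context: $G$ is $C_4$-free if it contains no $4$-cycle as a subgraph; $d_x$ is the degree of $x$. For $f,g:V\to\mathbb R$ define $2\Gamma(f,g)=\Delta(fg)-f\Delta g-g\Delta f$ and $2\Gamma_2(f,g)=\Delta\Gamma(f,g)-\Gamma(f,\Delta g)-\Gamma(\Delta f,g)$, $\Gamma_2(f)=\Gamma_2(f,f)$. $G$ satisfies $CD(0,\infty)$ if $\Gamma_2(f)(x)\ge0$ for all $f:V\to\mathbb R$ and all $x\in V$. The friendship graph $F_k$ is obtained from $k$ triangles by identifying one vertex of each into a single common vertex. *)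

theory Defs
  imports
    Complex_Main
    "Graph_Theory.Pair_Digraph"
    "Graph_Theory.Digraph_Component"
    "Graph_Theory.Digraph_Isomorphism"
begin

text \<open>
  Simple undirected graphs, finite or infinite, are symmetric loop-free pair digraphs
  (locale \<^locale>\<open>pair_bidirected_digraph\<close>): an edge is a pair of opposite arcs, so the
  degree of a vertex is its out-degree.
\<close>

abbreviation degree :: "'a pair_pre_digraph \<Rightarrow> 'a \<Rightarrow> nat" where
  "degree G x \<equiv> out_degree (with_proj G) x"

definition locally_finite :: "'a pair_pre_digraph \<Rightarrow> bool" where
  "locally_finite G \<longleftrightarrow> (\<forall>x \<in> pverts G. finite (out_arcs (with_proj G) x))"

definition min_degree_at_least :: "'a pair_pre_digraph \<Rightarrow> nat \<Rightarrow> bool" where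
  "min_degree_at_least G n \<longleftrightarrow> (\<forall>x \<in> pverts G. n \<le> degree G x)"

text \<open>
  A directed cycle of length at least 3 of a symmetric digraph passes through pairwise distinct
  vertices, hence is a cycle of the undirected graph; this fails for length 2 (a path u, v, u).
  The definition below is therefore only meaningful for \<open>n \<ge> 3\<close>.
\<close>

definition contains_cycle :: "'a pair_pre_digraph \<Rightarrow> nat \<Rightarrow> bool" where
  "contains_cycle G n \<longleftrightarrow> (\<exists>p. pre_digraph.cycle (with_proj G) p \<and> length p = n)"

definition C4_free :: "'a pair_pre_digraph \<Rightarrow> bool" where
  "C4_free G \<longleftrightarrow> \<not> contains_cycle G 4"

definition contains_triangle :: "'a pair_pre_digraph \<Rightarrow> bool" where
  "contains_triangle G \<longleftrightarrow> contains_cycle G 3"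

text \<open>
  Functions on the vertex set are total functions on the vertex type; for a well-formed graph the
  values of the operators below at a vertex do not depend on the values of their arguments outside
  \<^term>\<open>pverts G\<close>.
\<close>

definition laplacian :: "'a pair_pre_digraph \<Rightarrow> ('a \<Rightarrow> real) \<Rightarrow> 'a \<Rightarrow> real" where
  "laplacian G f x = (1 / real (degree G x)) * (\<Sum>y | x \<rightarrow>\<^bsub>with_proj G\<^esub> y. f y - f x)"

definition Gamma :: "'a pair_pre_digraph \<Rightarrow> ('a \<Rightarrow> real) \<Rightarrow> ('a \<Rightarrow> real) \<Rightarrow> 'a \<Rightarrow> real" where
  "Gamma G f g x =
     (laplacian G (\<lambda>y. f y * g y) x - f x * laplacian G g x - g x * laplacian G f x) / 2"

definition Gamma2 :: "'a pair_pre_digraph \<Rightarrow> ('a \<Rightarrow> real) \<Rightarrow> ('a \<Rightarrow> real) \<Rightarrow> 'a \<Rightarrow> real" where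
  "Gamma2 G f g x =
     (laplacian G (Gamma G f g) x - Gamma G f (laplacian G g) x - Gamma G (laplacian G f) g x) / 2"

definition CD_0_infinity :: "'a pair_pre_digraph \<Rightarrow> bool" where
  "CD_0_infinity G \<longleftrightarrow> (\<forall>f :: 'a \<Rightarrow> real. \<forall>x \<in> pverts G. 0 \<le> Gamma2 G f f x)"

text \<open>The \<open>i\<close>-th triangle is \<open>{0, 2 * i + 1, 2 * i + 2}\<close>; the common vertex is \<open>0\<close>.\<close>

definition friendship_graph :: "nat \<Rightarrow> nat pair_pre_digraph" where
  "friendship_graph k =
     \<lparr> pverts = {0..2 * k},
       parcs = (\<Union>i<k. {(u, v). u \<in> {0, 2 * i + 1, 2 * i + 2} \<and> v \<in> {0, 2 * i + 1, 2 * i + 2} \<and> u \<noteq> v}) \<rparr>"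

end

theory Submission
  imports Defs
begin

text \<open>
  For \<open>f x = 0\<close>, the number \<open>4 * d\<^sub>x * \<Gamma>\<^sub>2(f)(x)\<close> equals
  \<open>\<Sum>\<^sub>y 1/d\<^sub>y * \<Sum>\<^sub>z (f z - 2 * f y)\<^sup>2 - 2 * \<Sum>\<^sub>y (f y)\<^sup>2 + 2/d\<^sub>x * (\<Sum>\<^sub>y f y)\<^sup>2\<close>, with \<open>y \<sim> x\<close> and \<open>z \<sim> y\<close>. In a
  \<open>C\<^sub>4\<close>-free graph every vertex at distance 2 from \<open>x\<close> has only one neighbour adjacent to \<open>x\<close>, so its
  value can be chosen to make its term vanish, and every neighbour of \<open>x\<close> lies in at most one
  triangle with \<open>x\<close>. What remains is a quadratic form in the values on the neighbours of \<open>x\<close>. Four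
  test functions then suffice: an edge leaving a triangle vertex \<open>x\<close> outside all triangles is excluded
  by the values \<open>(1, 1, -2)\<close> at \<open>x\<close> and \<open>(1, -1)\<close> at its other end; two adjacent vertices of degree
  at least 4 are excluded by the values \<open>(2, 1, -1, -1)\<close> on two triangles at one of them; hence one
  vertex is adjacent to all others and these have degree 2. Finally the values 25 at the centre and
  1 at a leaf, seen from the other leaf of that triangle, bound the degree of the centre by 15.
\<close>

section \<open>Numbering of pairs and the arithmetic of friendship graphs\<close>

text \<open>Removing one orbit at a time, the orbit removed first gets the two largest labels
  \<open>2 * k + 1\<close> and \<open>2 * k + 2\<close>. On positive labels
  \<open>(n + 1) div 2\<close> is the index of the pair, in the numbering of the triangles of
  \<open>friendship_graph\<close>.\<close>

lemma finite_fixpoint_free_involution_enum: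
  assumes "finite A" "\<And>y. y \<in> A \<Longrightarrow> s y \<in> A" "\<And>y. y \<in> A \<Longrightarrow> s (s y) = y"
    "\<And>y. y \<in> A \<Longrightarrow> s y \<noteq> y"
  shows "\<exists>k h. bij_betw h A {1..2 * k::nat} \<and> (\<forall>y\<in>A. (h (s y) + 1) div 2 = (h y + 1) div 2)"
  using assms
proof (induction A rule: finite_psubset_induct)
  case (psubset A)
  show ?case
  proof (cases "A = {}")
    case True
    then show ?thesis by (intro exI[of _ 0]) (auto simp: bij_betw_def)
  next
    case False
    then obtain a where a: "a \<in> A" by blast
    let ?b = "s a"
    let ?A = "A - {a, ?b}"
    have b: "?b \<in> A" "?b \<noteq> a" "s ?b = a" using a psubset.prems by auto
    have st: "s y \<in> ?A" if "y \<in> ?A" for y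
      using that psubset.prems b by (metis Diff_iff insert_iff empty_iff)
    have "\<exists>k h. bij_betw h ?A {1..2 * k::nat} \<and> (\<forall>y\<in>?A. (h (s y) + 1) div 2 = (h y + 1) div 2)"
      by (rule psubset.IH) (use a psubset.prems st in auto)
    then obtain k h where h: "bij_betw h ?A {1..2 * k::nat}"
      and hs: "\<And>y. y \<in> ?A \<Longrightarrow> (h (s y) + 1) div 2 = (h y + 1) div 2"
      by blast
    let ?h = "h(a := 2 * k + 1, ?b := 2 * k + 2)"
    have "bij_betw ?h ?A {1..2 * k}"
      using h by (subst bij_betw_cong[of _ _ h]) auto
    moreover have "bij_betw ?h {a, ?b} {2 * k + 1, 2 * k + 2}"
      using b by (auto simp: bij_betw_def inj_on_def)
    ultimately have "bij_betw ?h (?A \<union> {a, ?b}) ({1..2 * k} \<union> {2 * k + 1, 2 * k + 2})"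
      by (rule bij_betw_combine) auto
    moreover have "?A \<union> {a, ?b} = A" using a b by auto
    moreover have "{1..2 * k} \<union> {2 * k + 1, 2 * k + 2} = {1..2 * Suc k}" by auto
    ultimately have "bij_betw ?h A {1..2 * Suc k}" by simp
    moreover have "(?h (s y) + 1) div 2 = (?h y + 1) div 2" if "y \<in> A" for y
    proof (cases "y \<in> {a, ?b}")
      case True
      then show ?thesis using b by auto
    next
      case False
      then have "y \<in> ?A" using that by simp
      with st[OF this] hs[OF this] show ?thesis by auto
    qed
    ultimately show ?thesis by blast
  qed
qed

lemma digraph_iso_with_projI:
  assumes "pair_wf_digraph G" "pair_wf_digraph H"
    and h: "bij_betw h (pverts G) (pverts H)"
    and arcs: "\<And>u v. u \<in> pverts G \<Longrightarrow> v \<in> pverts G \<Longrightarrow> (u, v) \<in> parcs G \<longleftrightarrow> (h u, h v) \<in> parcs H"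
  shows "digraph_iso (with_proj G) (with_proj H)"
proof -
  interpret G: pair_wf_digraph G by fact
  interpret H: pair_wf_digraph H by fact
  let ?f = "\<lparr>iso_verts = h, iso_arcs = map_prod h h, iso_head = snd, iso_tail = fst\<rparr>"
  have inj: "inj_on h (pverts G)" and im: "h ` pverts G = pverts H"
    using h by (auto simp: bij_betw_def)
  have sub: "parcs G \<subseteq> pverts G \<times> pverts G"
    by (auto dest: G.wellformed')
  have "inj_on (map_prod h h) (parcs G)"
    using inj_on_subset[OF map_prod_inj_on[OF inj inj] sub] .
  moreover have "map_prod h h ` parcs G = parcs H"
  proof (intro equalityI subsetI)
    fix e assume "e \<in> map_prod h h ` parcs G"
    then show "e \<in> parcs H" using arcs sub by auto
  next
    fix e assume e: "e \<in> parcs H"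
    obtain p q where pq: "e = (p, q)" by force
    then have "p \<in> h ` pverts G" "q \<in> h ` pverts G"
      using e im by (auto dest: H.wellformed')
    then obtain u v where "u \<in> pverts G" "v \<in> pverts G" "p = h u" "q = h v" by blast
    then show "e \<in> map_prod h h ` parcs G" using arcs e pq by (auto intro!: rev_image_eqI[of "(u,v)"])
  qed
  ultimately show ?thesis
    unfolding digraph_iso_def pre_digraph.digraph_isomorphism_def
    using inj im G.wf_digraph_axioms
    by (intro exI[of _ ?f]) (auto simp: with_proj_def app_iso_def)
qed

text \<open>For positive \<open>n\<close>, \<open>(n + 1) div 2 = i + 1\<close> holds exactly when
  \<open>n\<close> is \<open>2 * i + 1\<close> or \<open>2 * i + 2\<close>, so lying in a common
  triangle becomes an arithmetic condition.\<close>

lemma friendship_graph_arcs_iff: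
  "(u, v) \<in> parcs (friendship_graph k) \<longleftrightarrow>
     u \<le> 2 * k \<and> v \<le> 2 * k \<and> u \<noteq> v \<and> (u = 0 \<or> v = 0 \<or> (u + 1) div 2 = (v + 1) div 2)"
proof
  assume "(u, v) \<in> parcs (friendship_graph k)"
  then show "u \<le> 2 * k \<and> v \<le> 2 * k \<and> u \<noteq> v \<and> (u = 0 \<or> v = 0 \<or> (u + 1) div 2 = (v + 1) div 2)"
    by (auto simp: friendship_graph_def)
next
  assume *: "u \<le> 2 * k \<and> v \<le> 2 * k \<and> u \<noteq> v \<and> (u = 0 \<or> v = 0 \<or> (u + 1) div 2 = (v + 1) div 2)"
  \<comment> \<open>One end may be the centre 0, which lies in every triangle; the larger end is
    positive and fixes the triangle.\<close>
  define i where "i = (max u v + 1) div 2 - 1"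
  have "u \<in> {0, 2 * i + 1, 2 * i + 2}" "v \<in> {0, 2 * i + 1, 2 * i + 2}" "i < k"
    using * unfolding i_def by (auto simp: max_def)
  then show "(u, v) \<in> parcs (friendship_graph k)"
    using * by (auto simp: friendship_graph_def)
qed

lemma pair_wf_digraph_friendship_graph: "pair_wf_digraph (friendship_graph k)"
  by unfold_locales (auto simp: friendship_graph_def)

section \<open>Neighbourhoods and degrees in \<open>C4_free\<close> graphs\<close>

locale C4_free_CD_graph = pair_bidirected_digraph G for G :: "'a pair_pre_digraph" +
  assumes locally_finite: "locally_finite G"
    and C4_free: "C4_free G"
    and min_degree: "min_degree_at_least G 2"
    and CD: "CD_0_infinity G"
begin

abbreviation N :: "'a \<Rightarrow> 'a set" where
  "N x \<equiv> {y. (x, y) \<in> parcs G}"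

abbreviation d :: "'a \<Rightarrow> real" where
  "d x \<equiv> real (card (N x))"

lemma out_arcs_eq: "out_arcs (with_proj G) x = Pair x ` N x"
  by (auto simp: out_arcs_def)

lemma degree_eq: "degree G x = card (N x)"
  unfolding out_degree_def out_arcs_eq by (rule card_image) (auto simp: inj_on_def)

lemma N_sym: "(x, y) \<in> parcs G \<longleftrightarrow> (y, x) \<in> parcs G"
  using arcs_symmetric by blast

lemma N_irrefl [simp]: "(x, x) \<notin> parcs G"
  using pair_no_loops by fastforce

lemma finite_N [simp]: "finite (N x)"
proof (cases "x \<in> pverts G")
  case True
  then show ?thesis
    using locally_finite finite_imageD[of "Pair x" "N x"]
    by (auto simp: locally_finite_def out_arcs_eq inj_on_def)
next
  case False
  then have "N x = {}" by (auto dest: wellformed')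
  then show ?thesis by simp
qed

lemma card_N_ge_2: "x \<in> pverts G \<Longrightarrow> 2 \<le> card (N x)"
  using min_degree by (auto simp: min_degree_at_least_def degree_eq)

lemma d_ge_2: "x \<in> pverts G \<Longrightarrow> 2 \<le> d x"
  using card_N_ge_2 by force

lemma inverse_d_le: "x \<in> pverts G \<Longrightarrow> 1 / d x \<le> 1 / 2"
  using d_ge_2[of x] by (intro divide_left_mono) auto

text \<open>Distinct common neighbours would close the 4-cycle a, y, b, z.\<close>

lemma common_neighbour_unique:
  assumes "a \<noteq> b" "y \<in> N a" "y \<in> N b" "z \<in> N a" "z \<in> N b"
  shows "y = z"
proof (rule ccontr)
  assume ne: "y \<noteq> z"
  let ?p = "[(a, y), (y, b), (b, z), (z, a)]"
  have "cycle ?p"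
    unfolding cycle_def using assms ne N_sym
    by (intro exI[of _ a]) (auto simp: awalk_def dest: wellformed')
  then show False
    using C4_free unfolding C4_free_def contains_cycle_def by fastforce
qed

section \<open>The curvature operators as sums over neighbours\<close>

lemma laplacian_eq: "laplacian G f x = (\<Sum>y\<in>N x. f y - f x) / d x"
  by (simp add: laplacian_def degree_eq)

lemma Gamma_eq: "Gamma G f g x = (\<Sum>y\<in>N x. (f y - f x) * (g y - g x)) / (2 * d x)"
proof -
  have "(\<Sum>y\<in>N x. (f y - f x) * (g y - g x)) =
      (\<Sum>y\<in>N x. f y * g y - f x * g x) - f x * (\<Sum>y\<in>N x. g y - g x) - g x * (\<Sum>y\<in>N x. f y - f x)"
    unfolding sum_distrib_left sum_subtractf[symmetric] by (rule sum.cong) (auto simp: algebra_simps)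
  then show ?thesis
    by (simp add: Gamma_def laplacian_eq diff_divide_distrib)
qed

text \<open>Adding a constant to \<open>f\<close> leaves \<open>Gamma2\<close> unchanged, so
  \<open>f x = 0\<close> loses no generality. Completing the square confines each value at distance
  2 to nonnegative terms that can be made to vanish.\<close>

lemma Gamma2_eq:
  assumes x: "x \<in> pverts G" and fx: "f x = 0"
  shows "4 * d x * Gamma2 G f f x =
    (\<Sum>y\<in>N x. (\<Sum>z\<in>N y. (f z - 2 * f y)\<^sup>2) / d y - 2 * (f y)\<^sup>2) + 2 / d x * (\<Sum>y\<in>N x. f y)\<^sup>2"
proof -
  have dx: "d x \<noteq> 0" using d_ge_2[OF x] by linarith
  let ?L = "laplacian G f" and ?g = "Gamma G f f"
  have inner: "2 * ?g y - 2 * f y * ?L y = (\<Sum>z\<in>N y. (f z - 2 * f y)\<^sup>2) / d y - (f y)\<^sup>2"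
    if "y \<in> N x" for y
  proof -
    have dy: "d y \<noteq> 0" using that d_ge_2[of y] wellformed' by fastforce
    have "2 * ?g y - 2 * f y * ?L y = (\<Sum>z\<in>N y. (f z - f y)\<^sup>2 - 2 * f y * (f z - f y)) / d y"
      unfolding sum_subtractf[of "\<lambda>z. (f z - f y)\<^sup>2"] sum_distrib_left[symmetric]
      by (simp add: Gamma_eq laplacian_eq diff_divide_distrib power2_eq_square)
    also have "(\<Sum>z\<in>N y. (f z - f y)\<^sup>2 - 2 * f y * (f z - f y))
        = (\<Sum>z\<in>N y. (f z - 2 * f y)\<^sup>2 - (f y)\<^sup>2)"
      by (rule sum.cong) (auto simp: power2_eq_square algebra_simps)
    also have "\<dots> / d y = (\<Sum>z\<in>N y. (f z - 2 * f y)\<^sup>2) / d y - (f y)\<^sup>2"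
      using dy by (simp add: sum_subtractf diff_divide_distrib)
    finally show ?thesis .
  qed
  have "4 * d x * Gamma2 G f f x = 2 * (\<Sum>y\<in>N x. ?g y - ?g x) - 2 * (\<Sum>y\<in>N x. f y * (?L y - ?L x))"
  proof -
    have "Gamma G ?L f x = Gamma G f ?L x" by (simp add: Gamma_eq mult.commute)
    then have "4 * d x * Gamma2 G f f x = 2 * d x * (laplacian G ?g x - 2 * Gamma G f ?L x)"
      by (simp add: Gamma2_def)
    also have "\<dots> = 2 * (\<Sum>y\<in>N x. ?g y - ?g x) - 2 * (\<Sum>y\<in>N x. f y * (?L y - ?L x))"
      using dx by (simp add: laplacian_eq[of ?g] Gamma_eq[of f ?L] fx field_simps)
    finally show ?thesis .
  qed
  also have "\<dots> = (\<Sum>y\<in>N x. 2 * ?g y - 2 * f y * ?L y) - 2 * d x * ?g x + 2 * ?L x * (\<Sum>y\<in>N x. f y)"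
    by (simp add: sum_subtractf sum_distrib_left algebra_simps)
  also have "2 * d x * ?g x = (\<Sum>y\<in>N x. (f y)\<^sup>2)"
    using dx by (simp add: Gamma_eq fx power2_eq_square)
  also have "2 * ?L x * (\<Sum>y\<in>N x. f y) = 2 / d x * (\<Sum>y\<in>N x. f y)\<^sup>2"
    by (simp add: laplacian_eq fx power2_eq_square)
  also have "(\<Sum>y\<in>N x. 2 * ?g y - 2 * f y * ?L y)
      = (\<Sum>y\<in>N x. (\<Sum>z\<in>N y. (f z - 2 * f y)\<^sup>2) / d y - (f y)\<^sup>2)"
    by (rule sum.cong) (auto simp: inner)
  finally show ?thesis by (simp add: sum_subtractf sum_distrib_left[symmetric])
qed

text \<open>
  The values at distance 2 from \<open>x\<close> are chosen as \<open>f z = 2 * f y\<close>, where \<open>y\<close> is the only common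
  neighbour of \<open>x\<close> and \<open>z\<close>; this minimises \<open>Gamma2\<close>.
\<close>

lemma curvature_form_nonneg:
  assumes x: "x \<in> pverts G" and S: "S \<subseteq> N x" and closed: "\<And>y. y \<in> S \<Longrightarrow> N y \<inter> N x \<subseteq> S"
  shows "0 \<le> (\<Sum>y\<in>S. (4 / d y - 2) * (g y)\<^sup>2 + (\<Sum>z\<in>N y \<inter> N x. (g z - 2 * g y)\<^sup>2) / d y)
    + 2 / d x * (\<Sum>y\<in>S. g y)\<^sup>2"
proof -
  \<comment> \<open>For \<open>v\<close> at distance 2 the sum has at most one term. It is empty if
    the common neighbour of \<open>x\<close> and \<open>v\<close> lies outside \<open>S\<close>,
    where the default value 0 again gives \<open>2 * f y\<close>.\<close>
  define f where "f v = (if v = x then 0 else if v \<in> N x then if v \<in> S then g v else 0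
    else 2 * (\<Sum>y\<in>N v \<inter> S. g y))" for v
  have fx: "f x = 0" by (simp add: f_def)
  have fS: "f y = g y" if "y \<in> S" for y using that S by (auto simp: f_def)
  have fN: "f y = 0" if "y \<in> N x - S" for y using that by (auto simp: f_def)
  have far: "f z = 2 * f y" if y: "y \<in> N x" and z: "z \<in> N y" "z \<noteq> x" "z \<notin> N x" for y z
  proof -
    have "v = y" if "v \<in> N z \<inter> S" for v
      using that S y z N_sym by (intro common_neighbour_unique[of z x]) auto
    then have "N z \<inter> S = {y} \<inter> S"
      using z N_sym by auto
    then show ?thesis using y z fS fN by (auto simp: f_def)
  qed
  \<comment> \<open>The neighbour \<open>x\<close> of \<open>y\<close> contributes the square of
    \<open>0 - 2 * f y\<close>; vertices at distance 2 from \<open>x\<close> contribute nothing by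
    \<open>far\<close>.\<close>
  have inner: "(\<Sum>z\<in>N y. (f z - 2 * f y)\<^sup>2) = 4 * (f y)\<^sup>2 + (\<Sum>z\<in>N y \<inter> N x. (f z - 2 * f y)\<^sup>2)"
    if y: "y \<in> N x" for y
  proof -
    have "(\<Sum>z\<in>N y. (f z - 2 * f y)\<^sup>2) = (\<Sum>z\<in>insert x (N y \<inter> N x). (f z - 2 * f y)\<^sup>2)"
      using y far by (intro sum.mono_neutral_right) (auto simp: N_sym[of y x])
    then show ?thesis by (simp add: fx)
  qed
  \<comment> \<open>A neighbour of \<open>y\<close> in \<open>S\<close> would force \<open>y\<close>
    into \<open>S\<close> by \<open>closed\<close>, so all values occurring here are 0.\<close>
  have outer: "(\<Sum>z\<in>N y. (f z - 2 * f y)\<^sup>2) / d y - 2 * (f y)\<^sup>2 = 0" if y: "y \<in> N x - S" for y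
  proof -
    have "f z = 0" if "z \<in> N y \<inter> N x" for z
      using that y closed[of z] fN[of z] N_sym[of y z] by auto
    then show ?thesis using y inner[of y] fN[OF y] by simp
  qed
  have "0 \<le> 4 * d x * Gamma2 G f f x"
    using CD x by (simp add: CD_0_infinity_def)
  also have "\<dots> = (\<Sum>y\<in>N x. (\<Sum>z\<in>N y. (f z - 2 * f y)\<^sup>2) / d y - 2 * (f y)\<^sup>2)
      + 2 / d x * (\<Sum>y\<in>N x. f y)\<^sup>2"
    by (rule Gamma2_eq[where f = f, OF x fx])
  also have "(\<Sum>y\<in>N x. f y) = (\<Sum>y\<in>S. g y)"
    using S fS fN by (intro sum.mono_neutral_cong_right) auto
  also have "(\<Sum>y\<in>N x. (\<Sum>z\<in>N y. (f z - 2 * f y)\<^sup>2) / d y - 2 * (f y)\<^sup>2) =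
      (\<Sum>y\<in>S. (4 / d y - 2) * (g y)\<^sup>2 + (\<Sum>z\<in>N y \<inter> N x. (g z - 2 * g y)\<^sup>2) / d y)"
  proof (rule sum.mono_neutral_cong_right)
    fix y assume y: "y \<in> S"
    have "(\<Sum>z\<in>N y \<inter> N x. (f z - 2 * f y)\<^sup>2) = (\<Sum>z\<in>N y \<inter> N x. (g z - 2 * g y)\<^sup>2)"
      using closed[OF y] fS y by (intro sum.cong) auto
    then show "(\<Sum>z\<in>N y. (f z - 2 * f y)\<^sup>2) / d y - 2 * (f y)\<^sup>2 =
        (4 / d y - 2) * (g y)\<^sup>2 + (\<Sum>z\<in>N y \<inter> N x. (g z - 2 * g y)\<^sup>2) / d y"
      using inner[of y] y S fS[OF y] by (auto simp: add_divide_distrib algebra_simps)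
  qed (use S outer in auto)
  finally show ?thesis .
qed

section \<open>Local structure from test functions\<close>

lemma common_neighbours_eq:
  assumes "(x, y) \<in> parcs G" "(x, z) \<in> parcs G" "(y, z) \<in> parcs G"
  shows "N y \<inter> N x = {z}"
proof -
  have "x \<noteq> y" using assms by auto
  then have "v = z" if "v \<in> N y \<inter> N x" for v
    using that assms by (intro common_neighbour_unique[of x y]) auto
  then show ?thesis using assms by blast
qed

lemma degree_eq_2_of_unpaired:
  assumes xy: "(x, y) \<in> parcs G" and xz: "(x, z) \<in> parcs G" and yz: "(y, z) \<in> parcs G"
    and xw: "(x, w) \<in> parcs G" and unpaired: "N w \<inter> N x = {}"
  shows "card (N w) = 2"
proof (rule ccontr)
  assume "card (N w) \<noteq> 2"
  have V: "x \<in> pverts G" "y \<in> pverts G" "z \<in> pverts G" "w \<in> pverts G"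
    using xy xz xw by (auto dest: wellformed')
  have "3 \<le> card (N w)" using card_N_ge_2[OF V(4)] \<open>card (N w) \<noteq> 2\<close> by linarith
  then have w: "1 / d w \<le> 1 / 3" by (intro divide_left_mono) auto
  have yz': "1 / d y \<le> 1 / 2" "1 / d z \<le> 1 / 2"
    using V inverse_d_le by blast+
  have Ny: "N y \<inter> N x = {z}" and Nz: "N z \<inter> N x = {y}"
    using common_neighbours_eq xy xz yz N_sym by blast+
  have ne: "y \<noteq> z" "w \<noteq> y" "w \<noteq> z" using Ny Nz unpaired yz by auto
  \<comment> \<open>The values sum to 0, so the degree of \<open>x\<close> drops out. The form is at
    most 5 + 16/3 - 12 < 0; with degree 2 at \<open>w\<close> the bound would only be 1, hence the
    separate treatment of that case.\<close>
  define g where "g = (\<lambda>v. if v = w then - 2 else 1 :: real)"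
  have "0 \<le> (\<Sum>v\<in>{y, z, w}. (4 / d v - 2) * (g v)\<^sup>2 + (\<Sum>u\<in>N v \<inter> N x. (g u - 2 * g v)\<^sup>2) / d v)
      + 2 / d x * (\<Sum>v\<in>{y, z, w}. g v)\<^sup>2"
    by (rule curvature_form_nonneg[OF V(1)]) (use Ny Nz unpaired xy xz xw in auto)
  also have "\<dots> = 5 * (1 / d y) + 5 * (1 / d z) + 16 * (1 / d w) - 12"
    using ne by (simp add: Ny Nz unpaired g_def)
  finally show False using w yz' by linarith
qed

text \<open>If the edge from \<open>x\<close> to \<open>w\<close> lay in no triangle,
  \<open>w\<close> would have degree 2, and the curvature at \<open>w\<close> itself would be
  negative for some function, because \<open>x\<close> has at least the three neighbours
  \<open>y\<close>, \<open>z\<close>, \<open>w\<close>.\<close>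

lemma paired_of_triangle:
  assumes xy: "(x, y) \<in> parcs G" and xz: "(x, z) \<in> parcs G" and yz: "(y, z) \<in> parcs G"
    and xw: "(x, w) \<in> parcs G"
  shows "\<exists>v. (x, v) \<in> parcs G \<and> (w, v) \<in> parcs G"
proof (rule ccontr)
  assume "\<not> ?thesis"
  then have unpaired: "N w \<inter> N x = {}" by blast
  have x: "x \<in> pverts G" and w: "w \<in> pverts G" using xw by (auto dest: wellformed')
  have "y \<noteq> z" "w \<noteq> y" "w \<noteq> z" using unpaired xy xz yz N_sym by auto
  then have "card {y, z, w} = 3" by simp
  moreover have "card {y, z, w} \<le> card (N x)" by (rule card_mono) (use xy xz xw in auto)
  ultimately have dx: "1 / d x \<le> 1 / 3" by (intro divide_left_mono) auto
  have "card (N w - {x}) = 1"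
    using degree_eq_2_of_unpaired[OF xy xz yz xw unpaired] xw N_sym by simp
  then obtain u where "N w - {x} = {u}" by (auto simp: card_1_singleton_iff)
  then have Nw: "N w = {x, u}" "u \<noteq> x" using xw N_sym by auto
  have u: "u \<in> pverts G" using Nw wellformed' by blast
  have Nx: "N x \<inter> N w = {}" using unpaired by blast
  have Nu: "N u \<inter> N w = {}" using Nw Nx N_sym by auto
  have du: "1 / d u \<le> 1 / 2" using u by (rule inverse_d_le)
  \<comment> \<open>Again the sum is 0. The bound is 4/3 + 2 - 4 < 0; degree 2 at \<open>x\<close>
    would give only 0.\<close>
  define g where "g = (\<lambda>v. if v = x then 1 else - 1 :: real)"
  have "0 \<le> (\<Sum>v\<in>{x, u}. (4 / d v - 2) * (g v)\<^sup>2 + (\<Sum>t\<in>N v \<inter> N w. (g t - 2 * g v)\<^sup>2) / d v)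
      + 2 / d w * (\<Sum>v\<in>{x, u}. g v)\<^sup>2"
    by (rule curvature_form_nonneg[OF w]) (use Nx Nu Nw in auto)
  also have "\<dots> = 4 * (1 / d x) + 4 * (1 / d u) - 4"
    using Nw(2) by (simp add: Nx Nu g_def)
  finally show False using dx du by linarith
qed

text \<open>Since every edge at a triangle vertex lies in a triangle, degree other than 2 means at
  least two triangles there, so degree at least 4. Two adjacent such vertices contradict the
  curvature condition.\<close>

lemma degree_eq_2_of_high_degree_neighbour:
  assumes tri: "(x, y) \<in> parcs G" "(x, z) \<in> parcs G" "(y, z) \<in> parcs G"
    and dx: "card (N x) \<noteq> 2"
  shows "card (N y) = 2"
proof (rule ccontr)
  assume dy: "card (N y) \<noteq> 2"
  have V: "x \<in> pverts G" "y \<in> pverts G" "z \<in> pverts G"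
    using tri by (auto dest: wellformed')
  \<comment> \<open>A third neighbour \<open>u\<close> of \<open>a\<close> lies in a triangle with
    \<open>a\<close>, which avoids \<open>b\<close> and \<open>c\<close> because each edge is in at
    most one triangle.\<close>
  have second_pair: "\<exists>u v. (a, u) \<in> parcs G \<and> (a, v) \<in> parcs G \<and> (u, v) \<in> parcs G \<and> card {b, c, u, v} = 4"
    if t: "(a, b) \<in> parcs G" "(a, c) \<in> parcs G" "(b, c) \<in> parcs G" and da: "card (N a) \<noteq> 2" for a b c
  proof -
    have "b \<noteq> c" using t by auto
    then have "N a \<noteq> {b, c}" using da by auto
    then obtain u where u: "(a, u) \<in> parcs G" "u \<noteq> b" "u \<noteq> c" using t by auto
    obtain v where v: "(a, v) \<in> parcs G" "(u, v) \<in> parcs G" using paired_of_triangle[OF t u(1)] by blast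
    have "N b \<inter> N a = {c}" "N c \<inter> N a = {b}"
      using common_neighbours_eq t N_sym by blast+
    then have "v \<noteq> b" "v \<noteq> c" using u v N_sym by auto
    moreover have "u \<noteq> v" using v by auto
    ultimately have "card {b, c, u, v} = 4" using u \<open>b \<noteq> c\<close> by simp
    then show ?thesis using u v by blast
  qed
  have four: "1 / d a \<le> 1 / 4"
    if t: "(a, b) \<in> parcs G" "(a, c) \<in> parcs G" "(b, c) \<in> parcs G" and da: "card (N a) \<noteq> 2" for a b c
  proof -
    obtain u v where uv: "(a, u) \<in> parcs G" "(a, v) \<in> parcs G" "card {b, c, u, v} = 4"
      using second_pair[OF t da] by blast
    have "card {b, c, u, v} \<le> card (N a)" by (rule card_mono) (use t uv in auto)
    then show ?thesis using uv by (intro divide_left_mono) auto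
  qed
  obtain u v where uv: "(x, u) \<in> parcs G" "(x, v) \<in> parcs G" "(u, v) \<in> parcs G"
    and "card {y, z, u, v} = 4"
    using second_pair[OF tri dx] by blast
  then have ne: "y \<noteq> z" "y \<noteq> u" "y \<noteq> v" "z \<noteq> u" "z \<noteq> v" "u \<noteq> v"
    by (auto simp: card_insert_if split: if_splits)
  have bounds: "1 / d x \<le> 1 / 4" "1 / d y \<le> 1 / 4" "1 / d z \<le> 1 / 2" "1 / d u \<le> 1 / 2" "1 / d v \<le> 1 / 2"
    using four[OF tri dx] four[of y x z] tri dy N_sym V(3)
      inverse_d_le[of z] inverse_d_le[of u] inverse_d_le[of v] wellformed'(2)[OF uv(1)] wellformed'(2)[OF uv(2)]
    by blast+
  have Ns: "N y \<inter> N x = {z}" "N z \<inter> N x = {y}" "N u \<inter> N x = {v}" "N v \<inter> N x = {u}"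
    using common_neighbours_eq tri uv N_sym by blast+
  \<comment> \<open>The value 1 at \<open>z\<close> makes the square of \<open>g y - 2 * g z\<close>
    vanish. The values sum to 1, and the form is at most 55/4 - 14 < 0.\<close>
  define g where "g = (\<lambda>t. if t = y then 2 else if t = z then 1 else - 1 :: real)"
  have "0 \<le> (\<Sum>t\<in>{y, z, u, v}. (4 / d t - 2) * (g t)\<^sup>2 + (\<Sum>s\<in>N t \<inter> N x. (g s - 2 * g t)\<^sup>2) / d t)
      + 2 / d x * (\<Sum>t\<in>{y, z, u, v}. g t)\<^sup>2"
    by (rule curvature_form_nonneg[OF V(1)]) (use Ns tri uv in auto)
  also have "\<dots> = 25 * (1 / d y) + 4 * (1 / d z) + 5 * (1 / d u) + 5 * (1 / d v) + 2 * (1 / d x) - 14"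
    using ne by (simp add: Ns g_def)
  finally show False using bounds by linarith
qed

lemma degree_le_15_of_leaves:
  assumes tri: "(x, y) \<in> parcs G" "(x, z) \<in> parcs G" "(y, z) \<in> parcs G"
    and leaves: "card (N y) = 2" "card (N z) = 2"
  shows "card (N x) \<le> 15"
proof (rule ccontr)
  assume "\<not> card (N x) \<le> 15"
  then have dx: "1 / d x \<le> 1 / 16" by (intro divide_left_mono) auto
  have y: "y \<in> pverts G" using tri by (auto dest: wellformed')
  have "x \<noteq> z" using tri by auto
  have Ns: "N x \<inter> N y = {z}" "N z \<inter> N y = {x}"
    using common_neighbours_eq tri N_sym by blast+
  \<comment> \<open>With value \<open>a\<close> at \<open>x\<close> and 1 at \<open>z\<close>, the
    coefficient of the square of \<open>a\<close> is \<open>8 / d x - 1 / 2\<close>, which vanishes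
    at degree 16. There the form is \<open>49 / 16 - a / 4\<close>, negative for
    \<open>a > 49 / 4\<close>; 25 is one such choice, and larger degrees only decrease the
    form.\<close>
  define g where "g = (\<lambda>t. if t = x then 25 else 1 :: real)"
  have "0 \<le> (\<Sum>t\<in>{x, z}. (4 / d t - 2) * (g t)\<^sup>2 + (\<Sum>s\<in>N t \<inter> N y. (g s - 2 * g t)\<^sup>2) / d t)
      + 2 / d y * (\<Sum>t\<in>{x, z}. g t)\<^sup>2"
    by (rule curvature_form_nonneg[OF y]) (use Ns tri N_sym in auto)
  also have "\<dots> = 4901 * (1 / d x) - 619 / 2"
    using \<open>x \<noteq> z\<close> leaves by (simp add: Ns g_def)
  finally show False using dx by linarith
qed

section \<open>Global structure and the isomorphism\<close>

lemma pverts_subset_of_closed: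
  assumes conn: "Digraph_Component.connected (with_proj G)"
    and x: "x \<in> pverts G" "x \<in> A"
    and closed: "\<And>y z. y \<in> A \<Longrightarrow> (y, z) \<in> parcs G \<Longrightarrow> z \<in> A"
  shows "pverts G \<subseteq> A"
proof
  fix v assume v: "v \<in> pverts G"
  \<comment> \<open>\<open>connected\<close> is strong connectedness of the symmetric closure, which
    is \<open>G\<close> itself here.\<close>
  have "mk_symmetric (with_proj G) = G"
    using N_sym by (intro pair_pre_digraph.equality) (auto simp: mk_symmetric_def)
  then have "x \<rightarrow>\<^sup>*\<^bsub>with_proj G\<^esub> v"
    using conn x v by (auto simp: Digraph_Component.connected_def strongly_connected_def)
  then show "v \<in> A"
    by (induction rule: reachable_induct) (use x closed in auto)
qed

lemma triangle_obtain:
  assumes "contains_triangle G"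
  obtains x y z where "(x, y) \<in> parcs G" "(x, z) \<in> parcs G" "(y, z) \<in> parcs G"
proof -
  obtain p where p: "cycle p" "length p = 3"
    using assms by (auto simp: contains_triangle_def contains_cycle_def)
  then obtain a1 b1 a2 b2 a3 b3 where "p = [(a1, b1), (a2, b2), (a3, b3)]"
    by (auto simp: numeral_3_eq_3 length_Suc_conv)
  with p(1) have "(a1, a2) \<in> parcs G" "(a3, a1) \<in> parcs G" "(a2, a3) \<in> parcs G"
    by (auto simp: cycle_def awalk_def)
  then show ?thesis using that N_sym by blast
qed

lemma iso_friendship_graph:
  assumes conn: "Digraph_Component.connected (with_proj G)" and tri: "contains_triangle G"
  shows "\<exists>k. 1 \<le> k \<and> k \<le> 7 \<and> digraph_iso (with_proj G) (with_proj (friendship_graph k))"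
proof -
  let ?A = "{x. \<exists>y z. (x, y) \<in> parcs G \<and> (x, z) \<in> parcs G \<and> (y, z) \<in> parcs G}"
  obtain a where a: "a \<in> ?A" using triangle_obtain[OF tri] by blast
  then have aV: "a \<in> pverts G" by (auto dest: wellformed')
  \<comment> \<open>Lying in a triangle propagates along edges, so by connectedness it holds
    everywhere.\<close>
  have "pverts G \<subseteq> ?A"
  proof (rule pverts_subset_of_closed[OF conn aV a])
    fix y z assume "y \<in> ?A" and yz: "(y, z) \<in> parcs G"
    then obtain v where "(y, v) \<in> parcs G" "(z, v) \<in> parcs G"
      using paired_of_triangle by blast
    then show "z \<in> ?A" using yz N_sym by blast
  qed
  then have paired: "\<exists>v. (x, v) \<in> parcs G \<and> (w, v) \<in> parcs G" if "(x, w) \<in> parcs G" for x w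
    using that paired_of_triangle wellformed'(1)[OF that] by blast
  \<comment> \<open>The centre is a vertex of degree other than 2 if there is one. Otherwise any
    vertex serves, and the graph will be a single triangle.\<close>
  obtain x where x: "x \<in> pverts G" and leaf: "\<And>y. (x, y) \<in> parcs G \<Longrightarrow> card (N y) = 2"
  proof (cases "\<forall>y\<in>pverts G. card (N y) = 2")
    case True
    then show ?thesis using aV that[of a] by (auto dest: wellformed')
  next
    case False
    then obtain x where "x \<in> pverts G" "card (N x) \<noteq> 2" by blast
    then show ?thesis
      using that[of x] paired degree_eq_2_of_high_degree_neighbour by blast
  qed
  \<comment> \<open>\<open>s y\<close> is the third vertex of the triangle on the edge from
    \<open>x\<close> to \<open>y\<close>; it pairs off the neighbours of \<open>x\<close>.\<close>
  define s where "s y = (SOME v. (x, v) \<in> parcs G \<and> (y, v) \<in> parcs G)" for y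
  have s: "(x, s y) \<in> parcs G" "(y, s y) \<in> parcs G" if "(x, y) \<in> parcs G" for y
    using someI_ex[OF paired[OF that]] by (auto simp: s_def)
  have Ny: "N y = {x, s y}" if "(x, y) \<in> parcs G" for y
  proof -
    have "x \<noteq> s y" using s[OF that] by auto
    moreover have "{x, s y} \<subseteq> N y" using s[OF that] that N_sym by auto
    ultimately show ?thesis using leaf[OF that] card_subset_eq[of "N y" "{x, s y}"] by simp
  qed
  have s_uniq: "v = s y" if "(x, y) \<in> parcs G" "(x, v) \<in> parcs G" "(y, v) \<in> parcs G" for y v
  proof -
    have "v \<in> {x, s y}" using Ny[OF that(1)] that(3) by blast
    then show ?thesis using that(2) by auto
  qed
  have "pverts G \<subseteq> insert x (N x)"
    by (rule pverts_subset_of_closed[OF conn x]) (use Ny s in auto)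
  then have V: "pverts G = insert x (N x)" using x by (auto dest: wellformed')
  have "\<exists>k h. bij_betw h (N x) {1..2 * k::nat} \<and> (\<forall>y\<in>N x. (h (s y) + 1) div 2 = (h y + 1) div 2)"
  proof (rule finite_fixpoint_free_involution_enum)
    fix y assume "y \<in> N x"
    then have y: "(x, y) \<in> parcs G" by simp
    show "s y \<in> N x" using s[OF y] by simp
    show "s (s y) = y" using s_uniq[of "s y" y] s[OF y] y N_sym[of "s y" y] by simp
    show "s y \<noteq> y" using s[OF y] by auto
  qed simp
  then obtain k h where h: "bij_betw h (N x) {1..2 * k::nat}"
    and hs: "\<And>y. (x, y) \<in> parcs G \<Longrightarrow> (h (s y) + 1) div 2 = (h y + 1) div 2" by auto
  have card: "card (N x) = 2 * k" using bij_betw_same_card[OF h] by simp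
  then have k1: "1 \<le> k" using card_N_ge_2[OF x] by simp
  then have "N x \<noteq> {}" using card by force
  then obtain y where y: "(x, y) \<in> parcs G" by blast
  have "card (N x) \<le> 15"
    by (rule degree_le_15_of_leaves[OF y s[OF y]]) (use leaf s y in auto)
  \<comment> \<open>The degree of the centre is even, so the bound 15 gives 14.\<close>
  then have k7: "k \<le> 7" using card by simp
  let ?h = "h(x := 0)"
  have pos: "1 \<le> h y" "h y \<le> 2 * k" if "(x, y) \<in> parcs G" for y
    using bij_betwE[OF h] that by auto
  have "bij_betw ?h (N x) {1..2 * k}"
    using h by (subst bij_betw_cong[of _ _ h]) auto
  then have "bij_betw ?h (insert x (N x)) (insert (?h x) {1..2 * k})"
    by (intro notIn_Un_bij_betw[of x "N x" ?h, unfolded Un_insert_right Un_empty_right]) auto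
  moreover have "insert (?h x) {1..2 * k} = pverts (friendship_graph k)"
    by (auto simp: friendship_graph_def)
  ultimately have bij: "bij_betw ?h (pverts G) (pverts (friendship_graph k))"
    using V by simp
  have inj: "u = v" if "(x, u) \<in> parcs G" "(x, v) \<in> parcs G" "h u = h v" for u v
    using h that by (auto simp: bij_betw_def inj_on_def)
  have "digraph_iso (with_proj G) (with_proj (friendship_graph k))"
  proof (rule digraph_iso_with_projI[OF pair_wf_digraph_axioms pair_wf_digraph_friendship_graph bij])
    fix u v assume uv: "u \<in> pverts G" "v \<in> pverts G"
    show "(u, v) \<in> parcs G \<longleftrightarrow> (?h u, ?h v) \<in> parcs (friendship_graph k)"
    proof (cases "u = x \<or> v = x")
      case True
      then show ?thesis
        using uv V pos N_sym[of u x] by (fastforce simp: friendship_graph_arcs_iff)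
    next
      case False
      then have u: "(x, u) \<in> parcs G" and v: "(x, v) \<in> parcs G" using uv V by auto
      have "(u, v) \<in> parcs G \<longleftrightarrow> v = s u" using s_uniq s u v by blast
      also have "\<dots> \<longleftrightarrow> u \<noteq> v \<and> (h u + 1) div 2 = (h v + 1) div 2"
      proof
        assume "v = s u"
        then show "u \<noteq> v \<and> (h u + 1) div 2 = (h v + 1) div 2" using hs[OF u] s[OF u] by auto
      next
        assume uv': "u \<noteq> v \<and> (h u + 1) div 2 = (h v + 1) div 2"
        have "u \<noteq> s u" using s[OF u] by auto
        then have "h u \<noteq> h (s u)" "h u \<noteq> h v" using inj u v s uv' by blast+
        \<comment> \<open>Only two labels share a pair index, and both \<open>h v\<close> and
          \<open>h (s u)\<close> differ from \<open>h u\<close>.\<close>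
        then have "h v = h (s u)" using hs[OF u] uv' by linarith
        then show "v = s u" using inj u v s by blast
      qed
      also have "\<dots> \<longleftrightarrow> (?h u, ?h v) \<in> parcs (friendship_graph k)"
        using False pos[OF u] pos[OF v] inj[OF u v] by (auto simp: friendship_graph_arcs_iff)
      finally show ?thesis .
    qed
  qed
  then show ?thesis using k1 k7 by blast
qed

end

theorem theorem4p1:
  fixes G :: "'a pair_pre_digraph"
  assumes "pair_bidirected_digraph G"
    and "locally_finite G"
    and "Digraph_Component.connected (with_proj G)"
    and "C4_free G"
    and "min_degree_at_least G 2"
    and "CD_0_infinity G"
    and "contains_triangle G"
  shows "\<exists>k. 1 \<le> k \<and> k \<le> 7 \<and> digraph_iso (with_proj G) (with_proj (friendship_graph k))"
proof -
  interpret C4_free_CD_graph G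
    using assms by (intro C4_free_CD_graph.intro C4_free_CD_graph_axioms.intro)
  show ?thesis using assms by (intro iso_friendship_graph)
qed

end
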